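(* Let $\alpha\in(1,2)$ and let $\lambda_n$ denote the $n$-th eigenvalue ($n>0$) of the operator $-D_0^\alpha$ on $(0,1)$ with Dirichlet boundary conditions $u(0)=u(1)=0$, enumerated as in the context. Then, as $n\to+\infty$, the magnitude $|\lambda_n|$ and the phase $\arg(\lambda_n)$ satisfy $$|\lambda_n| \sim \left(\left(2\pi n + (1-\alpha)\tfrac{\pi}{2}\right)^2+ \left((1-\alpha)\ln (2\pi n) + \ln \tfrac{\alpha}{\Gamma(2-\alpha)}\right)^2\right)^{\frac{\alpha}{2}}\sim (2\pi n)^\alpha,$$ $$\arg(\lambda_n) \sim \pi- \alpha\arctan\left(\frac{2\pi n + (1-\alpha)\tfrac{\pi}{2}}{(\alpha-1)\ln (2\pi n) - \ln \tfrac{\alpha}{\Gamma(2-\alpha)}}\right)\sim \frac{(2-\alpha)\pi}{2}.$$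
   Context: For $\alpha\in(1,2)$, the left-sided Caputo fractional derivative is $$D_0^\alpha u(x) = \frac{1}{\Gamma(2-\alpha)}\int_0^x\frac{u''(t)}{(x-t)^{\alpha-1}}\,dt.$$ An eigenvalue of $-D_0^\alpha$ is a number $\lambda\in\mathbb{C}$ for which the problem $-D_0^\alpha u=\lambda u$ on $(0,1)$, $u(0)=u(1)=0$, has a nontrivial solution, normalized by $u'(0)=1$. The eigenvalues are exactly the numbers $\lambda$ with $E_{\alpha,2}(-\lambda)=0$, where $$E_{\alpha,\beta}(z)=\sum_{k=0}^\infty \frac{z^k}{\Gamma(\beta+\alpha k)}$$ is the two-parameter Mittag-Leffler function. Enumeration: it is known that all zeros of $E_{\alpha,2}$ of sufficiently large modulus are simple and can be labelled $z_n$, with $n$ an integer of large absolute value, so that (principal branch of the power) $$z_n^{1/\alpha} = 2n\pi \mathrm{i} - (\alpha-1)\left(\ln (2\pi |n|) +\frac{\pi}{2}\,\mathrm{sign}(n)\,\mathrm{i}\right) + \ln \frac{\alpha}{\Gamma(2-\alpha)} + d_n,\qquad d_n=O\left(\frac{\ln|n|}{|n|}\right).$$ The zeros, and hence the eigenvalues, occur in complex conjugate pairs, so only $n>0$ is considered, and from each conjugate pair $\{-z_n,-\overline{z_n}\}$ of eigenvalues ($n>0$ large) $\lambda_n$ denotes the one in the upper half-plane. Here $\arg$ is the principal argument, and $a_n\sim b_n$ means $a_n/b_n\to1$ as $n\to+\infty$. *)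

theory Defs
  imports "HOL-Analysis.Analysis" "HOL-Library.Landau_Symbols"
begin

definition mittag_leffler :: "real \<Rightarrow> real \<Rightarrow> complex \<Rightarrow> complex" where
  "mittag_leffler \<alpha> \<beta> z = (\<Sum>k. z ^ k / complex_of_real (Gamma (\<beta> + \<alpha> * real k)))"

definition second_deriv :: "(real \<Rightarrow> complex) \<Rightarrow> real \<Rightarrow> complex" where
  "second_deriv u t = vector_derivative (\<lambda>s. vector_derivative u (at s)) (at t)"

definition caputo_integrand :: "real \<Rightarrow> (real \<Rightarrow> complex) \<Rightarrow> real \<Rightarrow> real \<Rightarrow> complex" where
  "caputo_integrand \<alpha> u x t = second_deriv u t / complex_of_real ((x - t) powr (\<alpha> - 1))"

text \<open>Left-sided Caputo derivative of order \<open>\<alpha>\<close> in the open interval from 1 to 2, with base point 0.\<close>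

definition caputo_deriv :: "real \<Rightarrow> (real \<Rightarrow> complex) \<Rightarrow> real \<Rightarrow> complex" where
  "caputo_deriv \<alpha> u x =
     complex_of_real (1 / Gamma (2 - \<alpha>)) * (LBINT t:{0<..<x}. caputo_integrand \<alpha> u x t)"

text \<open>
  The regularity under which the Caputo derivative is meaningful at every point of (0,1).
  Integrability has to be required separately, since the Bochner integral of a
  non-integrable function is 0 by convention.
\<close>

definition caputo_admissible :: "real \<Rightarrow> (real \<Rightarrow> complex) \<Rightarrow> bool" where
  "caputo_admissible \<alpha> u \<longleftrightarrow>
     continuous_on {0..1} u \<and>
     (\<forall>x\<in>{0<..<1}. u differentiable (at x)) \<and>
     (\<forall>x\<in>{0<..<1}. (\<lambda>s. vector_derivative u (at s)) differentiable (at x)) \<and>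
     (\<forall>x\<in>{0<..<1}. set_integrable lborel {0<..<x} (caputo_integrand \<alpha> u x))"

text \<open>
  Eigenvalues of minus the Caputo derivative on (0,1) with Dirichlet boundary conditions.
  A solution with vanishing (one-sided) derivative at 0 is trivial, so normalizing this
  derivative to 1 is no restriction.
\<close>

definition caputo_dirichlet_eigenvalue :: "real \<Rightarrow> complex \<Rightarrow> bool" where
  "caputo_dirichlet_eigenvalue \<alpha> \<mu> \<longleftrightarrow>
     (\<exists>u. caputo_admissible \<alpha> u \<and>
          (\<forall>x\<in>{0<..<1}. - caputo_deriv \<alpha> u x = \<mu> * u x) \<and>
          u 0 = 0 \<and> u 1 = 0 \<and>
          (\<exists>x\<in>{0..1}. u x \<noteq> 0) \<and>
          (u has_vector_derivative 1) (at 0 within {0..1}))"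

text \<open>
  The labelling of the zeros of \<open>mittag_leffler \<alpha> 2\<close> of large modulus by integers of large
  absolute value; the values \<open>z n\<close> for the finitely many remaining \<open>n\<close> are irrelevant.
  The membership in \<open>O[cofinite]\<close> bounds the remainder (\<open>d n\<close>) as the absolute value of the
  integer \<open>n\<close> tends to infinity.
\<close>

definition mittag_leffler_zero_labelling :: "real \<Rightarrow> (int \<Rightarrow> complex) \<Rightarrow> bool" where
  "mittag_leffler_zero_labelling \<alpha> z \<longleftrightarrow>
     (\<exists>N R. (\<forall>n. N \<le> \<bar>n\<bar> \<longrightarrow>
                mittag_leffler \<alpha> 2 (z n) = 0 \<and> deriv (mittag_leffler \<alpha> 2) (z n) \<noteq> 0) \<and>
            inj_on z {n. N \<le> \<bar>n\<bar>} \<and>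
            (\<forall>w. mittag_leffler \<alpha> 2 w = 0 \<and> R < cmod w \<longrightarrow> w \<in> z ` {n. N \<le> \<bar>n\<bar>})) \<and>
     (\<exists>d. (\<forall>\<^sub>F n in cofinite.
             z n powr complex_of_real (1 / \<alpha>) =
               2 * of_int n * complex_of_real pi * \<i>
               - complex_of_real (\<alpha> - 1) *
                   (complex_of_real (ln (2 * pi * \<bar>real_of_int n\<bar>))
                    + complex_of_real (pi / 2 * sgn (real_of_int n)) * \<i>)
               + complex_of_real (ln (\<alpha> / Gamma (2 - \<alpha>)))
               + d n) \<and>
          d \<in> O[cofinite](\<lambda>n. complex_of_real (ln \<bar>real_of_int n\<bar> / \<bar>real_of_int n\<bar>)))"

text \<open>
  \<open>lam n\<close>, for large \<open>n > 0\<close>, is the eigenvalue in the upper half-plane out of the conjugate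
  pair belonging to the zero \<open>z n\<close>.
\<close>

definition eigenvalue_enumeration ::
    "real \<Rightarrow> (int \<Rightarrow> complex) \<Rightarrow> (nat \<Rightarrow> complex) \<Rightarrow> bool" where
  "eigenvalue_enumeration \<alpha> z lam \<longleftrightarrow>
     (\<forall>\<^sub>F n in at_top. caputo_dirichlet_eigenvalue \<alpha> (lam n) \<and>
        lam n \<in> {- z (int n), - cnj (z (int n))} \<and> Im (lam n) > 0)"

end

theory Submission
  imports Defs "HOL-Real_Asymp.Real_Asymp"
begin

text \<open>
  Put \<open>w\<^sub>n = z\<^sub>n powr (1/\<alpha>)\<close>. In the expansion of \<open>w\<^sub>n\<close> that the labelling provides, the term
  \<open>2 n pi \<i>\<close> dominates the logarithm, the constants and the remainder, so
  \<open>w\<^sub>n / (2 pi n) \<longlonglongrightarrow> \<i>\<close> (\<open>root_over_index_tendsto_ii\<close>). As \<open>\<alpha> \<ge> 1\<close>, dividing the principal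
  argument by \<open>\<alpha>\<close> yields a principal argument again, so \<open>Arg z\<^sub>n = \<alpha> * Arg w\<^sub>n\<close> and
  \<open>\<bar>z\<^sub>n\<bar> = \<bar>w\<^sub>n\<bar>\<^sup>\<alpha>\<close>, which gives
  \<open>\<bar>z\<^sub>n\<bar> / (2 pi n)\<^sup>\<alpha> \<longlonglongrightarrow> 1\<close> and \<open>Arg z\<^sub>n \<longlonglongrightarrow> \<alpha> pi / 2\<close>.

  For \<open>1 < \<alpha> < 2\<close> the last limit lies strictly between \<open>0\<close> and \<open>pi\<close>, so the zeros with large
  positive index are in the upper half-plane. Hence the eigenvalue in the upper half-plane
  is \<open>- cnj z\<^sub>n\<close>, with modulus \<open>\<bar>z\<^sub>n\<bar>\<close> and argument \<open>pi - Arg z\<^sub>n\<close>. The explicit expressions in the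
  corollary have the same leading behaviour as the two limits just found:
  the logarithm is negligible against \<open>n\<close>, and the argument of the arctangent is a linear
  term over the logarithm times \<open>\<alpha> - 1 > 0\<close> (up to constants), which tends to \<open>+\<infinity>\<close>.
  Since the limit \<open>(2 - \<alpha>) pi / 2\<close> of the phase is nonzero, convergence to it is the same
  as asymptotic equivalence.
\<close>

text \<open>
  The hypothesis \<open>a \<ge> 1\<close> makes \<open>Arg z / a\<close> a principal argument again; for \<open>a < 1\<close>
  it could leave the interval \<open>{-pi<..pi}\<close>.
\<close>

lemma Arg_powr_inverse:
  fixes a :: real
  assumes "1 \<le> a" "z \<noteq> 0"
  shows "Arg (z powr complex_of_real (1 / a)) = Arg z / a"
proof -
  have bd: "- pi < Arg z" "Arg z \<le> pi" by (auto simp: mpi_less_Arg Arg_le_pi)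
  have "- (a * pi) \<le> - pi" "pi \<le> a * pi" using assms by auto
  with bd have "- (a * pi) < Arg z" "Arg z \<le> a * pi" by linarith+
  hence "- pi < Arg z / a" "Arg z / a \<le> pi" using assms(1) by (simp_all add: field_simps)
  moreover have "Im (complex_of_real (1 / a) * Ln z) = Arg z / a"
    using assms by (simp add: Arg_eq_Im_Ln)
  ultimately show ?thesis
    using assms by (simp add: powr_def Arg_exp)
qed

lemma norm_powr_inverse_powr:
  fixes a :: real
  assumes "a \<noteq> 0"
  shows "cmod (z powr complex_of_real (1 / a)) powr a = cmod z"
  using assms by (simp add: norm_powr_real_powr' powr_powr)

lemma Arg_minus_cnj:
  assumes "0 < Im z"
  shows "Arg (- cnj z) = pi - Arg z"
proof -
  have nz: "z \<noteq> 0" and nR: "cnj z \<notin> \<real>" using assms by (auto simp: complex_is_Real_iff)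
  have pos: "0 < Arg z" "Arg z < pi" using assms Arg_lt_pi by auto
  have "Arg (cnj z) = - Arg z" using assms by (auto simp: Arg_cnj complex_is_Real_iff)
  with pos nz show ?thesis by (simp add: Arg_minus)
qed

text \<open>
  The expansion of \<open>z\<^sub>n powr (1/\<alpha>)\<close> has the form
  \<open>2 n pi \<i> + O(ln n)\<close> as \<open>n \<longlonglongrightarrow> +\<infinity>\<close>, and \<open>ln n / n\<close> tends to \<open>0\<close>.
\<close>

lemma root_over_index_tendsto_ii:
  assumes "mittag_leffler_zero_labelling \<alpha> z"
  shows "(\<lambda>n. z (int n) powr complex_of_real (1 / \<alpha>) / complex_of_real (2 * pi * real n)) \<longlonglongrightarrow> \<i>"
proof -
  let ?w = "\<lambda>n. z (int n) powr complex_of_real (1 / \<alpha>)"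
  let ?L = "\<lambda>n. complex_of_real (ln (2 * pi * real n) / (2 * pi * real n))"
  let ?I = "\<lambda>n. complex_of_real (1 / (2 * pi * real n))"
  obtain d where ev: "\<forall>\<^sub>F n in cofinite.
             z n powr complex_of_real (1 / \<alpha>) =
               2 * of_int n * complex_of_real pi * \<i>
               - complex_of_real (\<alpha> - 1) *
                   (complex_of_real (ln (2 * pi * \<bar>real_of_int n\<bar>))
                    + complex_of_real (pi / 2 * sgn (real_of_int n)) * \<i>)
               + complex_of_real (ln (\<alpha> / Gamma (2 - \<alpha>)))
               + d n"
    and dO: "d \<in> O[cofinite](\<lambda>n. complex_of_real (ln \<bar>real_of_int n\<bar> / \<bar>real_of_int n\<bar>))"
    using assms unfolding mittag_leffler_zero_labelling_def by blast
  \<comment> \<open>The labelling speaks of all integers of large modulus; only the positive ones are followed.\<close>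
  have fl: "filterlim int cofinite sequentially"
    unfolding filterlim_iff eventually_cofinite cofinite_eq_sequentially[symmetric]
    by (auto dest: finite_vimageI[of _ int] simp: vimage_def)
  have "(\<lambda>n. d (int n)) \<in> O(\<lambda>n. complex_of_real (ln (real n) / real n))"
    using landau_o.big.compose[OF dO fl] by simp
  also have "(\<lambda>n. complex_of_real (ln (real n) / real n)) \<in> o(\<lambda>_. 1)"
  proof (rule smalloI_tendsto)
    have "(\<lambda>n. complex_of_real (ln (real n) / real n)) \<longlonglongrightarrow> of_real 0"
      by (rule tendsto_of_real) real_asymp
    thus "(\<lambda>n. complex_of_real (ln (real n) / real n) / 1) \<longlonglongrightarrow> 0"
      by simp
  qed auto
  finally have d0: "(\<lambda>n. d (int n)) \<longlonglongrightarrow> 0"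
    using smalloD_tendsto by force
  have L0: "(\<lambda>n. ln (2 * pi * real n) / (2 * pi * real n)) \<longlonglongrightarrow> 0"
    and I0: "(\<lambda>n. 1 / (2 * pi * real n)) \<longlonglongrightarrow> 0"
    by real_asymp+
  have "(\<lambda>n. \<i> - complex_of_real (\<alpha> - 1) * (?L n + complex_of_real (pi / 2) * \<i> * ?I n)
           + complex_of_real (ln (\<alpha> / Gamma (2 - \<alpha>))) * ?I n + d (int n) * ?I n)
         \<longlonglongrightarrow> \<i> - complex_of_real (\<alpha> - 1) * (of_real 0 + complex_of_real (pi / 2) * \<i> * of_real 0)
           + complex_of_real (ln (\<alpha> / Gamma (2 - \<alpha>))) * of_real 0 + 0 * of_real 0"
    by (intro tendsto_intros L0 I0 d0)
  hence "(\<lambda>n. \<i> - complex_of_real (\<alpha> - 1) * (?L n + complex_of_real (pi / 2) * \<i> * ?I n)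
           + complex_of_real (ln (\<alpha> / Gamma (2 - \<alpha>))) * ?I n + d (int n) * ?I n) \<longlonglongrightarrow> \<i>"
    by simp
  moreover have "\<forall>\<^sub>F n in sequentially.
      \<i> - complex_of_real (\<alpha> - 1) * (?L n + complex_of_real (pi / 2) * \<i> * ?I n)
        + complex_of_real (ln (\<alpha> / Gamma (2 - \<alpha>))) * ?I n + d (int n) * ?I n
      = ?w n / complex_of_real (2 * pi * real n)"
    using eventually_compose_filterlim[OF ev fl] eventually_gt_at_top[of 0]
  proof eventually_elim
    case (elim n)
    from elim(2) show ?case
      unfolding elim(1) by (simp add: field_simps)
  qed
  ultimately show ?thesis
    by (rule Lim_transform_eventually)
qed

text \<open>
  The positive factor \<open>2 pi n\<close> does not change arguments, and \<open>Arg\<close> is continuous at \<open>\<i>\<close>,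
  so \<open>Arg (z\<^sub>n powr (1/\<alpha>))\<close> tends to \<open>Arg \<i> = pi / 2\<close>.
\<close>

lemma zero_Arg_tendsto:
  assumes "1 \<le> \<alpha>" "mittag_leffler_zero_labelling \<alpha> z"
  shows "(\<lambda>n. Arg (z (int n))) \<longlonglongrightarrow> \<alpha> * pi / 2"
proof -
  let ?q = "\<lambda>n. z (int n) powr complex_of_real (1 / \<alpha>) / complex_of_real (2 * pi * real n)"
  have q: "?q \<longlonglongrightarrow> \<i>"
    by (rule root_over_index_tendsto_ii[OF assms(2)])
  have "(\<lambda>n. \<alpha> * Arg (?q n)) \<longlonglongrightarrow> \<alpha> * Arg \<i>"
    by (intro tendsto_intros isCont_tendsto_compose[OF continuous_at_Arg q])
      (auto simp: complex_nonpos_Reals_iff)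
  moreover have "\<forall>\<^sub>F n in sequentially. \<alpha> * Arg (?q n) = Arg (z (int n))"
    using tendsto_imp_eventually_ne[OF q complex_i_not_zero] eventually_gt_at_top[of 0]
  proof eventually_elim
    case (elim n)
    have "?q n = complex_of_real (1 / (2 * pi * real n)) * z (int n) powr complex_of_real (1 / \<alpha>)"
      by simp
    also have "Arg \<dots> = Arg (z (int n) powr complex_of_real (1 / \<alpha>))"
      using elim(2) by (intro Arg_times_of_real) simp
    also have "\<dots> = Arg (z (int n)) / \<alpha>"
      using elim(1) assms(1) by (intro Arg_powr_inverse) auto
    finally show ?case using assms(1) by simp
  qed
  ultimately have "(\<lambda>n. Arg (z (int n))) \<longlonglongrightarrow> \<alpha> * Arg \<i>"
    by (rule Lim_transform_eventually)
  thus ?thesis by simp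
qed

lemma zero_norm_asymp_equiv:
  assumes "\<alpha> \<noteq> 0" "mittag_leffler_zero_labelling \<alpha> z"
  shows "(\<lambda>n. cmod (z (int n))) \<sim>[at_top] (\<lambda>n. (2 * pi * real n) powr \<alpha>)"
proof (rule asymp_equivI')
  let ?w = "\<lambda>n. z (int n) powr complex_of_real (1 / \<alpha>)"
  have "(\<lambda>n. cmod (?w n / complex_of_real (2 * pi * real n)) powr \<alpha>) \<longlonglongrightarrow> cmod \<i> powr \<alpha>"
    by (intro tendsto_powr tendsto_norm root_over_index_tendsto_ii assms tendsto_const) auto
  moreover have "cmod (?w n / complex_of_real (2 * pi * real n)) powr \<alpha>
      = cmod (z (int n)) / (2 * pi * real n) powr \<alpha>" for n
    using norm_powr_inverse_powr[OF assms(1), of "z (int n)"]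
    by (simp add: norm_divide norm_mult powr_divide)
  ultimately show "(\<lambda>n. cmod (z (int n)) / (2 * pi * real n) powr \<alpha>) \<longlonglongrightarrow> 1"
    by simp
qed

lemma explicit_modulus_asymp_equiv:
  fixes a b c k :: real
  shows "(\<lambda>n. ((2 * pi * real n + c)\<^sup>2 + (b * ln (2 * pi * real n) + k)\<^sup>2) powr (a / 2))
           \<sim>[at_top] (\<lambda>n. (2 * pi * real n) powr a)"
proof (rule asymp_equivI')
  let ?m = "\<lambda>n. (2 * pi * real n + c)\<^sup>2 + (b * ln (2 * pi * real n) + k)\<^sup>2"
  have "(\<lambda>n. (2 * pi * real n + c) / (2 * pi * real n)) \<longlonglongrightarrow> 1"
    by real_asymp
  moreover have "(\<lambda>n. b * (ln (2 * pi * real n) / (2 * pi * real n)) + k * (1 / (2 * pi * real n)))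
      \<longlonglongrightarrow> b * 0 + k * 0"
  proof (intro tendsto_add tendsto_mult_left)
    show "(\<lambda>n. ln (2 * pi * real n) / (2 * pi * real n)) \<longlonglongrightarrow> 0" by real_asymp
    show "(\<lambda>n. 1 / (2 * pi * real n)) \<longlonglongrightarrow> 0" by real_asymp
  qed
  ultimately have "(\<lambda>n. ((2 * pi * real n + c) / (2 * pi * real n))\<^sup>2
      + (b * (ln (2 * pi * real n) / (2 * pi * real n)) + k * (1 / (2 * pi * real n)))\<^sup>2)
      \<longlonglongrightarrow> 1\<^sup>2 + (b * 0 + k * 0)\<^sup>2"
    by (rule tendsto_add[OF tendsto_power tendsto_power])
  moreover have "((2 * pi * real n + c) / (2 * pi * real n))\<^sup>2
      + (b * (ln (2 * pi * real n) / (2 * pi * real n)) + k * (1 / (2 * pi * real n)))\<^sup>2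
      = ?m n / (2 * pi * real n)\<^sup>2" for n
    by (simp only: times_divide_eq_right mult_1_right power_divide flip: add_divide_distrib)
  ultimately have "(\<lambda>n. ?m n / (2 * pi * real n)\<^sup>2) \<longlonglongrightarrow> 1"
    by simp
  hence "(\<lambda>n. (?m n / (2 * pi * real n)\<^sup>2) powr (a / 2)) \<longlonglongrightarrow> 1 powr (a / 2)"
    by (intro tendsto_powr tendsto_const) auto
  moreover have "\<forall>\<^sub>F n in sequentially. (?m n / (2 * pi * real n)\<^sup>2) powr (a / 2)
      = ?m n powr (a / 2) / (2 * pi * real n) powr a"
    using eventually_gt_at_top[of 0]
  proof eventually_elim
    case (elim n)
    have "(2 * pi * real n)\<^sup>2 = (2 * pi * real n) powr 2"
      using elim by (subst powr_numeral) auto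
    hence "((2 * pi * real n)\<^sup>2) powr (a / 2) = (2 * pi * real n) powr a"
      by (simp only: powr_powr) simp
    thus ?case
      by (subst powr_divide) auto
  qed
  ultimately show "(\<lambda>n. ?m n powr (a / 2) / (2 * pi * real n) powr a) \<longlonglongrightarrow> 1"
    using Lim_transform_eventually by force
qed

text \<open>
  The sign of \<open>b\<close> decides the limit: the quotient tends to \<open>+\<infinity>\<close> for \<open>b > 0\<close>, and then its
  arctangent tends to \<open>pi / 2\<close>.
\<close>

lemma explicit_phase_tendsto:
  fixes a b c k :: real
  assumes "0 < b"
  shows "(\<lambda>n. pi - a * arctan ((2 * pi * real n + c) / (b * ln (2 * pi * real n) - k)))
           \<longlonglongrightarrow> (2 - a) * pi / 2"
proof -
  have "filterlim (\<lambda>n. (2 * pi * real n + c) / (b * ln (2 * pi * real n) - k)) at_top sequentially"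
    using assms by real_asymp
  hence "(\<lambda>n. pi - a * arctan ((2 * pi * real n + c) / (b * ln (2 * pi * real n) - k)))
           \<longlonglongrightarrow> pi - a * (pi / 2)"
    by (intro tendsto_intros filterlim_compose[OF tendsto_arctan_at_top])
  thus ?thesis by (simp add: algebra_simps diff_divide_distrib)
qed

text \<open>
  The limit \<open>\<alpha> pi / 2\<close> of \<open>Arg z\<^sub>n\<close> lies in \<open>{0<..<pi}\<close>, so \<open>z\<^sub>n\<close> and therefore \<open>- cnj z\<^sub>n\<close> are
  eventually in the upper half-plane, while the other candidate \<open>- z\<^sub>n\<close> is not.
\<close>

lemma eigenvalue_eq_minus_cnj_zero:
  assumes "1 \<le> \<alpha>" "\<alpha> < 2" "mittag_leffler_zero_labelling \<alpha> z" "eigenvalue_enumeration \<alpha> z lam"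
  shows "\<forall>\<^sub>F n in sequentially. 0 < Im (z (int n)) \<and> lam n = - cnj (z (int n))"
proof -
  have lim: "(\<lambda>n. Arg (z (int n))) \<longlonglongrightarrow> \<alpha> * pi / 2"
    using assms by (intro zero_Arg_tendsto) auto
  have ev: "\<forall>\<^sub>F n in sequentially. lam n \<in> {- z (int n), - cnj (z (int n))} \<and> 0 < Im (lam n)"
    using assms(4) unfolding eigenvalue_enumeration_def by (rule eventually_mono) simp
  have "0 < \<alpha> * pi / 2" "\<alpha> * pi / 2 < pi" using assms by auto
  from ev order_tendstoD(1)[OF lim this(1)] order_tendstoD(2)[OF lim this(2)]
  show ?thesis
  proof eventually_elim
    case (elim n)
    hence "0 < Im (z (int n))" using Arg_lt_pi[of "z (int n)"] by auto
    with elim(1) show ?case by auto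
  qed
qed

theorem corollary2p1:
  fixes \<alpha> :: real and z :: "int \<Rightarrow> complex" and lam :: "nat \<Rightarrow> complex"
  assumes "1 < \<alpha>" and "\<alpha> < 2"
    and "mittag_leffler_zero_labelling \<alpha> z"
    and "eigenvalue_enumeration \<alpha> z lam"
  shows
    "((\<lambda>n. cmod (lam n)) \<sim>[at_top]
        (\<lambda>n. ((2 * pi * real n + (1 - \<alpha>) * (pi / 2))\<^sup>2
              + ((1 - \<alpha>) * ln (2 * pi * real n) + ln (\<alpha> / Gamma (2 - \<alpha>)))\<^sup>2) powr (\<alpha> / 2)))
     \<and> ((\<lambda>n. ((2 * pi * real n + (1 - \<alpha>) * (pi / 2))\<^sup>2
              + ((1 - \<alpha>) * ln (2 * pi * real n) + ln (\<alpha> / Gamma (2 - \<alpha>)))\<^sup>2) powr (\<alpha> / 2))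
        \<sim>[at_top] (\<lambda>n. (2 * pi * real n) powr \<alpha>))
     \<and> ((\<lambda>n. Arg (lam n)) \<sim>[at_top]
        (\<lambda>n. pi - \<alpha> * arctan ((2 * pi * real n + (1 - \<alpha>) * (pi / 2))
                / ((\<alpha> - 1) * ln (2 * pi * real n) - ln (\<alpha> / Gamma (2 - \<alpha>))))))
     \<and> ((\<lambda>n. pi - \<alpha> * arctan ((2 * pi * real n + (1 - \<alpha>) * (pi / 2))
                / ((\<alpha> - 1) * ln (2 * pi * real n) - ln (\<alpha> / Gamma (2 - \<alpha>)))))
        \<sim>[at_top] (\<lambda>n. (2 - \<alpha>) * pi / 2))"
proof -
  note a = assms(1,2) and lab = assms(3)
  let ?modulus = "\<lambda>n. ((2 * pi * real n + (1 - \<alpha>) * (pi / 2))\<^sup>2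
              + ((1 - \<alpha>) * ln (2 * pi * real n) + ln (\<alpha> / Gamma (2 - \<alpha>)))\<^sup>2) powr (\<alpha> / 2)"
  let ?phase = "\<lambda>n. pi - \<alpha> * arctan ((2 * pi * real n + (1 - \<alpha>) * (pi / 2))
                / ((\<alpha> - 1) * ln (2 * pi * real n) - ln (\<alpha> / Gamma (2 - \<alpha>))))"
  have ev: "\<forall>\<^sub>F n in sequentially. 0 < Im (z (int n)) \<and> lam n = - cnj (z (int n))"
    using a assms(3,4) by (intro eigenvalue_eq_minus_cnj_zero) auto

  have modulus: "?modulus \<sim>[at_top] (\<lambda>n. (2 * pi * real n) powr \<alpha>)"
    by (rule explicit_modulus_asymp_equiv)
  have "\<forall>\<^sub>F n in sequentially. cmod (lam n) = cmod (z (int n))"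
    using ev by (rule eventually_mono) simp
  hence "(\<lambda>n. cmod (lam n)) \<sim>[at_top] (\<lambda>n. cmod (z (int n)))"
    by (rule asymp_equiv_refl_ev)
  also have "\<dots> \<sim>[at_top] (\<lambda>n. (2 * pi * real n) powr \<alpha>)"
    using a lab by (intro zero_norm_asymp_equiv) auto
  also have "\<dots> \<sim>[at_top] ?modulus"
    using modulus by (rule asymp_equiv_symI)
  finally have norm_lam: "(\<lambda>n. cmod (lam n)) \<sim>[at_top] ?modulus" .

  have limit_nz: "(2 - \<alpha>) * pi / 2 \<noteq> 0" using a by simp
  have "?phase \<longlonglongrightarrow> (2 - \<alpha>) * pi / 2"
    using a by (intro explicit_phase_tendsto) simp
  hence phase: "?phase \<sim>[at_top] (\<lambda>n. (2 - \<alpha>) * pi / 2)"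
    using limit_nz by (rule tendsto_imp_asymp_equiv_const)
  have "\<forall>\<^sub>F n in sequentially. pi - Arg (z (int n)) = Arg (lam n)"
    using ev by (rule eventually_mono) (simp add: Arg_minus_cnj)
  moreover have "(\<lambda>n. pi - Arg (z (int n))) \<longlonglongrightarrow> pi - \<alpha> * pi / 2"
    using a lab by (intro tendsto_intros zero_Arg_tendsto) auto
  ultimately have "(\<lambda>n. Arg (lam n)) \<longlonglongrightarrow> pi - \<alpha> * pi / 2"
    by (rule Lim_transform_eventually[rotated])
  also have "pi - \<alpha> * pi / 2 = (2 - \<alpha>) * pi / 2"
    by (simp add: algebra_simps diff_divide_distrib)
  finally have "(\<lambda>n. Arg (lam n)) \<sim>[at_top] (\<lambda>n. (2 - \<alpha>) * pi / 2)"
    using limit_nz by (rule tendsto_imp_asymp_equiv_const)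
  also have "\<dots> \<sim>[at_top] ?phase"
    using phase by (rule asymp_equiv_symI)
  finally have Arg_lam: "(\<lambda>n. Arg (lam n)) \<sim>[at_top] ?phase" .

  from norm_lam modulus Arg_lam phase show ?thesis by blast
qed

end
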